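(* Let $(\mathfrak g,\mathfrak h,\phi)$ be a pre-Lie-morphism triple and let $(N,S)$ be a Nijenhuis pair on $(\mathfrak g,\mathfrak h,\phi)$. Then a deformation of the pre-Lie-morphism triple $(\mathfrak g,\mathfrak h,\phi)$ is obtained by putting, for all $x,y\in\mathfrak g$, $u,v\in\mathfrak h$, $$\omega(x,y)=x\cdot_{\mathfrak g}N(y)+N(x)\cdot_{\mathfrak g}y-N(x\cdot_{\mathfrak g}y),\quad \varpi(u,v)=u\cdot_{\mathfrak h}S(v)+S(u)\cdot_{\mathfrak h}v-S(u\cdot_{\mathfrak h}v),\quad \theta(x)=\phi(N(x))-S(\phi(x)),$$ i.e. $(\omega,\varpi,\theta)$ generates a $1$-parameter infinitesimal deformation of $(\mathfrak g,\mathfrak h,\phi)$. Furthermore, this deformation is trivial.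
   Context: All vector spaces are finite dimensional over an algebraically closed field $\mathbb K$ of characteristic $0$. A pre-Lie algebra is a vector space $\mathfrak g$ with a bilinear product $\cdot_{\mathfrak g}$ satisfying $(x\cdot_{\mathfrak g} y)\cdot_{\mathfrak g} z-x\cdot_{\mathfrak g}(y\cdot_{\mathfrak g} z)=(y\cdot_{\mathfrak g} x)\cdot_{\mathfrak g} z-y\cdot_{\mathfrak g}(x\cdot_{\mathfrak g} z)$. A pre-Lie-morphism triple $(\mathfrak g,\mathfrak h,\phi)$ consists of pre-Lie algebras $(\mathfrak g,\cdot_{\mathfrak g})$, $(\mathfrak h,\cdot_{\mathfrak h})$ and a linear map $\phi:\mathfrak g\to\mathfrak h$ with $\phi(x\cdot_{\mathfrak g}y)=\phi(x)\cdot_{\mathfrak h}\phi(y)$. A Nijenhuis operator on a pre-Lie algebra $(\mathfrak g,\cdot_{\mathfrak g})$ is a linear map $N:\mathfrak g\to\mathfrak g$ with $N(x)\cdot_{\mathfrak g}N(y)=N\big(N(x)\cdot_{\mathfrak g}y+x\cdot_{\mathfrak g}N(y)-N(x\cdot_{\mathfrak g}y)\big)$ for all $x,y$. A Nijenhuis pair on $(\mathfrak g,\mathfrak h,\phi)$ is a pair $(N,S)$ with $N\in\mathfrak{gl}(\mathfrak g)$ a Nijenhuis operator on $(\mathfrak g,\cdot_{\mathfrak g})$, $S\in\mathfrak{gl}(\mathfrak h)$ a Nijenhuis operator on $(\mathfrak h,\cdot_{\mathfrak h})$, and $S\circ\phi\circ N=S^2\circ\phi$. Deformations. Let $\omega\in\mathrm{Hom}(\otimes^2\mathfrak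 g,\mathfrak g)$, $\varpi\in\mathrm{Hom}(\otimes^2\mathfrak h,\mathfrak h)$, $\theta\in\mathrm{Hom}(\mathfrak g,\mathfrak h)$, and put $x\cdot_ty=x\cdot_{\mathfrak g}y+t\omega(x,y)$, $u\ast_tv=u\cdot_{\mathfrak h}v+t\varpi(u,v)$, $\phi_t(x)=\phi(x)+t\theta(x)$. If $\mathfrak g_t=(\mathfrak g,\cdot_t)$ and $\mathfrak h_t=(\mathfrak h,\ast_t)$ are pre-Lie algebras for all $t$ and $\phi_t:\mathfrak g_t\to\mathfrak h_t$ is a pre-Lie algebra homomorphism modulo $t^3$, then $(\omega,\varpi,\theta)$ is said to generate a $1$-parameter infinitesimal deformation $(\mathfrak g_t,\mathfrak h_t,\phi_t)$ of $(\mathfrak g,\mathfrak h,\phi)$. Two infinitesimal deformations $(\mathfrak g_t,\mathfrak h_t,\phi_t)$, $(\mathfrak g'_t,\mathfrak h'_t,\phi'_t)$ are equivalent if there are $N'\in\mathfrak{gl}(\mathfrak g)$, $S'\in\mathfrak{gl}(\mathfrak h)$ such that $\mathrm{Id}_{\mathfrak g}+tN':\mathfrak g_t\to\mathfrak g'_t$ and $\mathrm{Id}_{\mathfrak h}+tS':\mathfrak h_t\to\mathfrak h'_t$ are families of pre-Lie algebra isomorphisms and $\phi'_t\circ(\mathrm{Id}_{\mathfrak g}+tN')=(\mathrm{Id}_{\mathfrak h}+tS')\circ\phi_t$. A deformation is trivial if it is equivalent to the undeformed triple $((\mathfrak g,\cdot_{\mathfrak g}),(\mathfrak h,\cdot_{\mathfrak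 h}),\phi)$ (the deformation generated by $(0,0,0)$). Here $t$ is treated as a formal parameter: all these conditions are identities of polynomials in $t$, and $\mathrm{Id}+tN'$, $\mathrm{Id}+tS'$ are invertible over $\mathbb K[[t]]$. *)

theory Defs
  imports "HOL-Computational_Algebra.Computational_Algebra"
begin

section \<open>Pre-Lie algebras and Nijenhuis pairs\<close>

text \<open>
  The basic notions are stated over an arbitrary commutative ring of scalars, since they are used
  both over the ground field \<open>K\<close> and over \<open>K[[t]]\<close>. The underlying modules are whole types; the
  module structure is given by the scalar multiplication, as in the theory \<open>Modules\<close>.
\<close>

definition bilinear_map ::
  "('r::comm_ring_1 \<Rightarrow> 'a::ab_group_add \<Rightarrow> 'a) \<Rightarrow> ('r \<Rightarrow> 'b::ab_group_add \<Rightarrow> 'b) \<Rightarrow>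
   ('r \<Rightarrow> 'c::ab_group_add \<Rightarrow> 'c) \<Rightarrow> ('a \<Rightarrow> 'b \<Rightarrow> 'c) \<Rightarrow> bool"
  where "bilinear_map s1 s2 s3 f \<longleftrightarrow>
    (\<forall>x. module_hom s2 s3 (\<lambda>y. f x y)) \<and> (\<forall>y. module_hom s1 s3 (\<lambda>x. f x y))"

locale pre_lie_algebra = module scale
  for scale :: "'r::comm_ring_1 \<Rightarrow> 'a::ab_group_add \<Rightarrow> 'a" +
  fixes mult :: "'a \<Rightarrow> 'a \<Rightarrow> 'a"
  assumes bilinear: "bilinear_map scale scale scale mult"
    and pre_lie: "mult (mult x y) z - mult x (mult y z) = mult (mult y x) z - mult y (mult x z)"

locale pre_lie_hom =
  dom: pre_lie_algebra s1 m1 + cod: pre_lie_algebra s2 m2 + module_hom s1 s2 f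
  for s1 :: "'r::comm_ring_1 \<Rightarrow> 'a::ab_group_add \<Rightarrow> 'a" and m1
    and s2 :: "'r \<Rightarrow> 'b::ab_group_add \<Rightarrow> 'b" and m2
    and f :: "'a \<Rightarrow> 'b" +
  assumes hom_mult: "f (m1 x y) = m2 (f x) (f y)"

locale pre_lie_iso = pre_lie_hom +
  assumes bij: "bij f"

definition fin_dim :: "('k::field \<Rightarrow> 'a::ab_group_add \<Rightarrow> 'a) \<Rightarrow> bool"
  where "fin_dim s \<longleftrightarrow> (\<exists>B. finite_dimensional_vector_space s B)"

locale pre_lie_morphism_triple = pre_lie_hom sg mg sh mh \<phi>
  for sg :: "'k::field \<Rightarrow> 'g::ab_group_add \<Rightarrow> 'g" and mg
    and sh :: "'k \<Rightarrow> 'h::ab_group_add \<Rightarrow> 'h" and mh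
    and \<phi> :: "'g \<Rightarrow> 'h" +
  assumes fin_dim_dom: "fin_dim sg"
    and fin_dim_cod: "fin_dim sh"

definition nijenhuis_operator ::
  "('k::field \<Rightarrow> 'a::ab_group_add \<Rightarrow> 'a) \<Rightarrow> ('a \<Rightarrow> 'a \<Rightarrow> 'a) \<Rightarrow> ('a \<Rightarrow> 'a) \<Rightarrow> bool"
  where "nijenhuis_operator s m N \<longleftrightarrow>
    Vector_Spaces.linear s s N \<and>
    (\<forall>x y. m (N x) (N y) = N (m (N x) y + m x (N y) - N (m x y)))"

definition nijenhuis_pair ::
  "('k::field \<Rightarrow> 'g::ab_group_add \<Rightarrow> 'g) \<Rightarrow> ('g \<Rightarrow> 'g \<Rightarrow> 'g) \<Rightarrow>
   ('k \<Rightarrow> 'h::ab_group_add \<Rightarrow> 'h) \<Rightarrow> ('h \<Rightarrow> 'h \<Rightarrow> 'h) \<Rightarrow> ('g \<Rightarrow> 'h) \<Rightarrow>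
   ('g \<Rightarrow> 'g) \<Rightarrow> ('h \<Rightarrow> 'h) \<Rightarrow> bool"
  where "nijenhuis_pair sg mg sh mh \<phi> N S \<longleftrightarrow>
    nijenhuis_operator sg mg N \<and> nijenhuis_operator sh mh S \<and> S \<circ> \<phi> \<circ> N = S \<circ> S \<circ> \<phi>"


section \<open>Extension of scalars to formal power series\<close>

text \<open>
  For a finite-dimensional space \<open>V\<close> over \<open>K\<close>, the \<open>K[[t]]\<close>-module \<open>V \<otimes> K[[t]] = V[[t]]\<close> is the
  type \<open>'v fps\<close> of formal power series with coefficients in \<open>V\<close>. A bilinear map
  \<open>U \<times> V \<rightarrow> W\<close> extends to a \<open>K[[t]]\<close>-bilinear map \<open>U[[t]] \<times> V[[t]] \<rightarrow> W[[t]]\<close> by the Cauchy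
  product, and a linear map extends coefficientwise.
\<close>

definition ext_bilin ::
  "('a \<Rightarrow> 'b \<Rightarrow> 'c) \<Rightarrow> 'a fps \<Rightarrow> 'b fps \<Rightarrow> 'c::comm_monoid_add fps"
  where "ext_bilin f x y = Abs_fps (\<lambda>n. \<Sum>i=0..n. f (fps_nth x i) (fps_nth y (n - i)))"

definition ext_lin :: "('a \<Rightarrow> 'b) \<Rightarrow> 'a fps \<Rightarrow> 'b fps"
  where "ext_lin f x = Abs_fps (\<lambda>n. f (fps_nth x n))"

abbreviation ext_scale ::
  "('k::comm_ring_1 \<Rightarrow> 'a::ab_group_add \<Rightarrow> 'a) \<Rightarrow> 'k fps \<Rightarrow> 'a fps \<Rightarrow> 'a fps"
  where "ext_scale s \<equiv> ext_bilin s"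


section \<open>Infinitesimal deformations\<close>

text \<open>
  \<open>t\<close> is the formal variable \<open>fps_X\<close>. The maps below are the \<open>K[[t]]\<close>-(bi)linear extensions of
  \<open>m + t \<omega>\<close> and \<open>f + t \<theta>\<close>; in both definitions \<open>s\<close> is the scalar multiplication of the target.
\<close>

definition deform_mult ::
  "('k::comm_ring_1 \<Rightarrow> 'a::ab_group_add \<Rightarrow> 'a) \<Rightarrow> ('a \<Rightarrow> 'a \<Rightarrow> 'a) \<Rightarrow> ('a \<Rightarrow> 'a \<Rightarrow> 'a) \<Rightarrow>
   'a fps \<Rightarrow> 'a fps \<Rightarrow> 'a fps"
  where "deform_mult s m \<omega> x y = ext_bilin m x y + ext_scale s fps_X (ext_bilin \<omega> x y)"

definition deform_map ::
  "('k::comm_ring_1 \<Rightarrow> 'b::ab_group_add \<Rightarrow> 'b) \<Rightarrow> ('a \<Rightarrow> 'b) \<Rightarrow> ('a \<Rightarrow> 'b) \<Rightarrow> 'a fps \<Rightarrow> 'b fps"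
  where "deform_map s f \<theta> x = ext_lin f x + ext_scale s fps_X (ext_lin \<theta> x)"

text \<open>
  By \<open>K[[t]]\<close>-(bi)linearity, the identities below hold on \<open>V[[t]]\<close> iff they hold for constant
  series, where they are polynomial identities in \<open>t\<close>. Being equal
  modulo \<open>t\<^sup>3\<close> means agreeing in the coefficients of \<open>t\<^sup>0, t\<^sup>1, t\<^sup>2\<close>.
\<close>

definition generates_deformation ::
  "('k::field \<Rightarrow> 'g::ab_group_add \<Rightarrow> 'g) \<Rightarrow> ('g \<Rightarrow> 'g \<Rightarrow> 'g) \<Rightarrow>
   ('k \<Rightarrow> 'h::ab_group_add \<Rightarrow> 'h) \<Rightarrow> ('h \<Rightarrow> 'h \<Rightarrow> 'h) \<Rightarrow> ('g \<Rightarrow> 'h) \<Rightarrow>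
   ('g \<Rightarrow> 'g \<Rightarrow> 'g) \<Rightarrow> ('h \<Rightarrow> 'h \<Rightarrow> 'h) \<Rightarrow> ('g \<Rightarrow> 'h) \<Rightarrow> bool"
  where "generates_deformation sg mg sh mh \<phi> \<omega> \<pi> \<theta> \<longleftrightarrow>
    bilinear_map sg sg sg \<omega> \<and> bilinear_map sh sh sh \<pi> \<and> Vector_Spaces.linear sg sh \<theta> \<and>
    pre_lie_algebra (ext_scale sg) (deform_mult sg mg \<omega>) \<and>
    pre_lie_algebra (ext_scale sh) (deform_mult sh mh \<pi>) \<and>
    module_hom (ext_scale sg) (ext_scale sh) (deform_map sh \<phi> \<theta>) \<and>
    (\<forall>x y. \<forall>n<3.
       fps_nth (deform_map sh \<phi> \<theta> (deform_mult sg mg \<omega> x y)) n =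
       fps_nth (deform_mult sh mh \<pi> (deform_map sh \<phi> \<theta> x) (deform_map sh \<phi> \<theta> y)) n)"

definition equivalent_deformations ::
  "('k::field \<Rightarrow> 'g::ab_group_add \<Rightarrow> 'g) \<Rightarrow> ('g \<Rightarrow> 'g \<Rightarrow> 'g) \<Rightarrow>
   ('k \<Rightarrow> 'h::ab_group_add \<Rightarrow> 'h) \<Rightarrow> ('h \<Rightarrow> 'h \<Rightarrow> 'h) \<Rightarrow> ('g \<Rightarrow> 'h) \<Rightarrow>
   ('g \<Rightarrow> 'g \<Rightarrow> 'g) \<Rightarrow> ('h \<Rightarrow> 'h \<Rightarrow> 'h) \<Rightarrow> ('g \<Rightarrow> 'h) \<Rightarrow>
   ('g \<Rightarrow> 'g \<Rightarrow> 'g) \<Rightarrow> ('h \<Rightarrow> 'h \<Rightarrow> 'h) \<Rightarrow> ('g \<Rightarrow> 'h) \<Rightarrow> bool"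
  where "equivalent_deformations sg mg sh mh \<phi> \<omega> \<pi> \<theta> \<omega>' \<pi>' \<theta>' \<longleftrightarrow>
    generates_deformation sg mg sh mh \<phi> \<omega> \<pi> \<theta> \<and>
    generates_deformation sg mg sh mh \<phi> \<omega>' \<pi>' \<theta>' \<and>
    (\<exists>N' S'.
       Vector_Spaces.linear sg sg N' \<and> Vector_Spaces.linear sh sh S' \<and>
       pre_lie_iso (ext_scale sg) (deform_mult sg mg \<omega>) (ext_scale sg) (deform_mult sg mg \<omega>')
         (deform_map sg id N') \<and>
       pre_lie_iso (ext_scale sh) (deform_mult sh mh \<pi>) (ext_scale sh) (deform_mult sh mh \<pi>')
         (deform_map sh id S') \<and>
       deform_map sh \<phi> \<theta>' \<circ> deform_map sg id N' = deform_map sh id S' \<circ> deform_map sh \<phi> \<theta>)"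

definition trivial_deformation ::
  "('k::field \<Rightarrow> 'g::ab_group_add \<Rightarrow> 'g) \<Rightarrow> ('g \<Rightarrow> 'g \<Rightarrow> 'g) \<Rightarrow>
   ('k \<Rightarrow> 'h::ab_group_add \<Rightarrow> 'h) \<Rightarrow> ('h \<Rightarrow> 'h \<Rightarrow> 'h) \<Rightarrow> ('g \<Rightarrow> 'h) \<Rightarrow>
   ('g \<Rightarrow> 'g \<Rightarrow> 'g) \<Rightarrow> ('h \<Rightarrow> 'h \<Rightarrow> 'h) \<Rightarrow> ('g \<Rightarrow> 'h) \<Rightarrow> bool"
  where "trivial_deformation sg mg sh mh \<phi> \<omega> \<pi> \<theta> \<longleftrightarrow>
    equivalent_deformations sg mg sh mh \<phi> \<omega> \<pi> \<theta> (\<lambda>x y. 0) (\<lambda>u v. 0) (\<lambda>x. 0)"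


section \<open>Values on constant series\<close>

text \<open>On \<open>V \<subseteq> V[[t]]\<close> the deformed structures are given by the expected formulas.\<close>

lemma ext_bilin_const:
  assumes "\<And>x. f x 0 = 0" "\<And>y. f 0 y = 0"
  shows "ext_bilin f (fps_const x) (fps_const y) = fps_const (f x y)"
proof (rule fps_ext)
  fix n
  have "(\<Sum>i=0..n. f (fps_nth (fps_const x) i) (fps_nth (fps_const y) (n - i))) =
        (\<Sum>i=0..n. if i = 0 then f x (fps_nth (fps_const y) n) else 0)"
    by (rule sum.cong) (auto simp: assms)
  then show "fps_nth (ext_bilin f (fps_const x) (fps_const y)) n = fps_nth (fps_const (f x y)) n"
    by (simp add: ext_bilin_def assms)
qed

lemma ext_lin_const: "f 0 = 0 \<Longrightarrow> ext_lin f (fps_const x) = fps_const (f x)"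
  by (rule fps_ext) (simp add: ext_lin_def)

lemma bilinear_map_zero:
  assumes "bilinear_map s1 s2 s3 f"
  shows "f x 0 = 0" "f 0 y = 0"
  using assms module_hom.zero unfolding bilinear_map_def by fastforce+

lemma ext_scale_X_nth:
  assumes "module s"
  shows "fps_nth (ext_scale s fps_X x) n = (if n = 0 then 0 else fps_nth x (n - 1))"
proof -
  interpret module s by fact
  have "(\<Sum>i=0..n. s (fps_nth fps_X i) (fps_nth x (n - i))) =
        (\<Sum>i=0..n. if i = 1 then fps_nth x (n - 1) else 0)"
    by (rule sum.cong) auto
  then show ?thesis by (auto simp: ext_bilin_def)
qed

lemma deform_mult_const:
  assumes "bilinear_map s s s m" "bilinear_map s s s \<omega>"
  shows "deform_mult s m \<omega> (fps_const x) (fps_const y) =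
    Abs_fps (\<lambda>n. if n = 0 then m x y else if n = 1 then \<omega> x y else 0)"
proof -
  have "module s" using assms(1) unfolding bilinear_map_def module_hom_def by blast
  with assms show ?thesis
    by (intro fps_ext) (auto simp: deform_mult_def ext_bilin_const bilinear_map_zero ext_scale_X_nth)
qed

lemma deform_map_const:
  assumes "module_hom s1 s2 f" "module_hom s1 s2 \<theta>"
  shows "deform_map s2 f \<theta> (fps_const x) =
    Abs_fps (\<lambda>n. if n = 0 then f x else if n = 1 then \<theta> x else 0)"
proof -
  have "module s2" using assms(1) unfolding module_hom_def by blast
  with assms show ?thesis
    by (intro fps_ext) (auto simp: deform_map_def ext_lin_const module_hom.zero ext_scale_X_nth)
qed

end

theory Submission
  imports Defs
begin

text \<open>
  Write \<open>E = Id + t N\<close> and \<open>F = Id + t S\<close>, acting on \<open>g[[t]]\<close> and \<open>h[[t]]\<close>. Comparing powers of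
  \<open>t\<close> in \<open>E (x \<cdot>\<^sub>t y) = E x \<cdot> E y\<close>, degree \<open>0\<close> is trivial, degree \<open>1\<close> is the formula
  defining \<open>\<omega>\<close>, and degree \<open>2\<close> is \<open>N (\<omega> x y) = N x \<cdot> N y\<close>, which is the Nijenhuis identity. So
  \<open>E\<close> is multiplicative from \<open>\<cdot>\<^sub>t\<close> to the undeformed product, and it is bijective since its
  constant term is the identity. Hence \<open>\<cdot>\<^sub>t\<close> is a pre-Lie product, as the pullback of one along an
  injective homomorphism, and \<open>E\<close> is the isomorphism required for triviality
  (\<open>nijenhuis_deform_iso\<close>). The same holds for \<open>F\<close>.

  Likewise \<open>\<phi> E = F \<phi>\<^sub>t\<close>: degree \<open>1\<close> is the formula defining \<open>\<theta>\<close>, and degree \<open>2\<close> is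
  \<open>S \<theta> = S \<phi> N - S\<^sup>2 \<phi> = 0\<close>, the compatibility of a Nijenhuis pair (\<open>nijenhuis_pair_intertwines\<close>).
  Since \<open>E\<close>, \<open>F\<close>, \<open>\<phi>\<close> are multiplicative and \<open>F\<close> is injective, \<open>\<phi>\<^sub>t\<close> is multiplicative
  in every degree, in particular modulo \<open>t\<^sup>3\<close>.

  What remains is that extension of scalars to \<open>K[[t]]\<close> preserves modules, bilinear maps and the
  pre-Lie identity. Additivity holds coefficientwise. The laws that nest two operations (associativity
  of scalars, compatibility with a product, the pre-Lie identity) are trilinear, and
  \<open>ext_trilin\<close> reduces them to the same laws over \<open>K\<close>.
\<close>

section \<open>Extension of scalars preserves multilinear identities\<close>

lemma bilinear_map_additive:
  assumes "bilinear_map s1 s2 s3 f"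
  shows "additive (f x)" "additive (\<lambda>x. f x y)"
  using assms by (auto simp: bilinear_map_def module_hom_iff additive_def)

lemma module_hom_additive: "module_hom s1 s2 f \<Longrightarrow> additive f"
  by (simp add: module_hom_iff additive_def)

lemma bilinear_map_module:
  assumes "bilinear_map s1 s2 s3 f"
  shows "module s1" "module s2" "module s3"
  using assms by (auto simp: bilinear_map_def module_hom_iff)

text \<open>
  The coefficients of a composite of two extended bilinear maps are convolutions over
  \<open>i + j + k = n\<close>. Both ways of nesting give this one form, so that an identity between the
  composites may be checked on the underlying trilinear maps.
\<close>

definition ext_trilin ::
  "('a \<Rightarrow> 'b \<Rightarrow> 'c \<Rightarrow> 'd) \<Rightarrow> 'a fps \<Rightarrow> 'b fps \<Rightarrow> 'c fps \<Rightarrow> 'd::comm_monoid_add fps"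
  where "ext_trilin T x y z = Abs_fps (\<lambda>n. \<Sum>j=0..n. \<Sum>i=0..j.
    T (fps_nth x i) (fps_nth y (j - i)) (fps_nth z (n - j)))"

lemma ext_bilin_nest_left:
  assumes "\<And>z. additive (\<lambda>u. f u z)"
  shows "ext_bilin f (ext_bilin g x y) z = ext_trilin (\<lambda>a b c. f (g a b) c) x y z"
  by (rule fps_ext) (simp add: ext_bilin_def ext_trilin_def additive.sum[OF assms])

lemma ext_bilin_nest_right:
  assumes "\<And>u. additive (f u)"
  shows "ext_bilin f x (ext_bilin g y z) = ext_trilin (\<lambda>a b c. f a (g b c)) x y z"
proof (rule fps_ext)
  fix n
  show "fps_nth (ext_bilin f x (ext_bilin g y z)) n =
      fps_nth (ext_trilin (\<lambda>a b c. f a (g b c)) x y z) n"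
    using fps_mult_assoc_lemma[of "\<lambda>i j k. f (fps_nth x i) (g (fps_nth y j) (fps_nth z k))" n n]
    by (simp add: ext_bilin_def ext_trilin_def additive.sum[OF assms])
qed

lemma ext_trilin_swap: "ext_trilin (\<lambda>a b c. T b a c) x y z = ext_trilin T y x z"
proof (rule fps_ext)
  fix n
  have "(\<Sum>i=0..j. T (fps_nth y (j - i)) (fps_nth x i) (fps_nth z (n - j))) =
        (\<Sum>i=0..j. T (fps_nth y i) (fps_nth x (j - i)) (fps_nth z (n - j)))" for j
    using fps_mult_commute_lemma[of "\<lambda>a b. T (fps_nth y a) (fps_nth x b) (fps_nth z (n - j))" j]
    by simp
  then show "fps_nth (ext_trilin (\<lambda>a b c. T b a c) x y z) n = fps_nth (ext_trilin T y x z) n"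
    by (simp add: ext_trilin_def)
qed

lemma ext_trilin_diff:
  "ext_trilin (\<lambda>a b c. T a b c - U a b c) x y z =
    ext_trilin T x y z - ext_trilin U x y (z :: _ fps)"
  for T :: "'a \<Rightarrow> 'b \<Rightarrow> 'c \<Rightarrow> 'd::ab_group_add"
  by (rule fps_ext) (simp add: ext_trilin_def sum_subtractf)

lemma ext_bilin_add_right:
  assumes "\<And>u. additive (f u)"
  shows "ext_bilin f x (y + z) = ext_bilin f x y + ext_bilin f x z"
  by (rule fps_ext) (simp add: ext_bilin_def additive.add[OF assms] sum.distrib)

lemma ext_bilin_add_left:
  assumes "\<And>z. additive (\<lambda>u. f u z)"
  shows "ext_bilin f (x + y) z = ext_bilin f x z + ext_bilin f y z"
  by (rule fps_ext) (simp add: ext_bilin_def additive.add[OF assms] sum.distrib)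

lemma ext_scale_module:
  assumes "module s"
  shows "module (ext_scale s)"
proof -
  interpret module s by fact
  have add: "additive (s a)" "additive (\<lambda>a. s a x)" for a x
    by (simp_all add: additive_def scale_right_distrib scale_left_distrib)
  have mult_eq: "c * d = ext_bilin (*) c d" for c d :: "'a fps"
    by (rule fps_ext) (simp add: ext_bilin_def fps_mult_nth)
  have one: "ext_scale s 1 x = x" for x
  proof (rule fps_ext)
    fix n
    have "(\<Sum>i=0..n. s (fps_nth 1 i) (fps_nth x (n - i))) =
          (\<Sum>i=0..n. if i = 0 then fps_nth x n else 0)"
      by (rule sum.cong) auto
    then show "fps_nth (ext_scale s 1 x) n = fps_nth x n"
      by (simp add: ext_bilin_def)
  qed
  show ?thesis
    by standard
      (simp_all add: one mult_eq add ext_bilin_add_left ext_bilin_add_right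
        ext_bilin_nest_left ext_bilin_nest_right)
qed

lemma ext_bilin_bilinear:
  assumes "bilinear_map s1 s2 s3 f"
  shows "bilinear_map (ext_scale s1) (ext_scale s2) (ext_scale s3) (ext_bilin f)"
proof -
  note mods = bilinear_map_module[OF assms]
  have add: "additive (f x)" "additive (\<lambda>x. f x y)" for x y
    using bilinear_map_additive[OF assms] by auto
  have add_s3: "additive (s3 c)" for c
    using mods by (simp add: additive_def module.scale_right_distrib)
  have scale: "f (s1 c x) y = s3 c (f x y)" "f x (s2 c y) = s3 c (f x y)" for c x y
    using assms by (auto simp: bilinear_map_def module_hom_iff)
  have left: "ext_bilin f (ext_scale s1 c x) y = ext_scale s3 c (ext_bilin f x y)" for c x y
    by (simp add: ext_bilin_nest_left ext_bilin_nest_right add add_s3 scale)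
  have "ext_bilin f x (ext_scale s2 c y) = ext_scale s3 c (ext_bilin f x y)" for c x y
    using ext_trilin_swap[of "\<lambda>c a b. s3 c (f a b)" x c y]
    by (simp add: ext_bilin_nest_right add add_s3 scale)
  with left show ?thesis
    using mods unfolding bilinear_map_def module_hom_iff
    by (simp add: ext_scale_module add ext_bilin_add_left ext_bilin_add_right)
qed

lemma ext_bilin_pre_lie:
  assumes "pre_lie_algebra s m"
  shows "pre_lie_algebra (ext_scale s) (ext_bilin m)"
proof -
  interpret pre_lie_algebra s m by fact
  have add: "additive (m x)" "additive (\<lambda>x. m x y)" for x y
    using bilinear_map_additive[OF bilinear] by auto
  have "ext_bilin m (ext_bilin m x y) z - ext_bilin m x (ext_bilin m y z) =
        ext_bilin m (ext_bilin m y x) z - ext_bilin m y (ext_bilin m x z)" for x y z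
    using ext_trilin_swap[of "\<lambda>a b c. m (m a b) c - m a (m b c)" x y z]
    by (simp add: ext_bilin_nest_left ext_bilin_nest_right add pre_lie
        flip: ext_trilin_diff)
  with ext_bilin_bilinear[OF bilinear] ext_scale_module[OF module_axioms] show ?thesis
    by (simp add: pre_lie_algebra_def pre_lie_algebra_axioms_def)
qed

lemma ext_bilin_ext_lin:
  "ext_bilin f (ext_lin g x) y = ext_bilin (\<lambda>a b. f (g a) b) x y"
  "ext_bilin k u (ext_lin h v) = ext_bilin (\<lambda>a b. k a (h b)) u v"
  by (simp_all add: ext_bilin_def ext_lin_def)

lemma ext_lin_ext_bilin:
  assumes "additive g"
  shows "ext_lin g (ext_bilin f x y) = ext_bilin (\<lambda>a b. g (f a b)) x y"
  by (rule fps_ext) (simp add: ext_bilin_def ext_lin_def additive.sum[OF assms])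

lemma ext_bilin_add_diff:
  "ext_bilin (\<lambda>a b. f a b + g a b - h a b) x y =
    ext_bilin f x y + ext_bilin g x y - ext_bilin h x y"
  for f :: "'a \<Rightarrow> 'b \<Rightarrow> 'c::ab_group_add"
  by (rule fps_ext) (simp add: ext_bilin_def sum_subtractf sum.distrib)

lemma ext_lin_module_hom:
  assumes "module_hom s1 s2 f"
  shows "module_hom (ext_scale s1) (ext_scale s2) (ext_lin f)"
proof -
  have "f (s1 c x) = s2 c (f x)" for c x
    using assms by (simp add: module_hom_iff)
  then have "ext_lin f (ext_scale s1 c x) = ext_scale s2 c (ext_lin f x)" for c x
    by (simp add: ext_lin_ext_bilin ext_bilin_ext_lin module_hom_additive[OF assms])
  moreover have "ext_lin f (x + y) = ext_lin f x + ext_lin f y" for x y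
    using assms by (intro fps_ext) (simp add: ext_lin_def module_hom_iff)
  ultimately show ?thesis
    using assms by (simp add: module_hom_iff ext_scale_module)
qed


section \<open>Deformed products and maps\<close>

lemma deform_mult_bilinear:
  assumes "bilinear_map s s s m" "bilinear_map s s s \<omega>"
  shows "bilinear_map (ext_scale s) (ext_scale s) (ext_scale s) (deform_mult s m \<omega>)"
proof -
  have "module_pair (ext_scale s) (ext_scale s)"
    using ext_scale_module[OF bilinear_map_module(1)[OF assms(1)]] by (simp add: module_pair_def)
  with assms[THEN ext_bilin_bilinear] show ?thesis
    unfolding bilinear_map_def deform_mult_def
    by (auto intro!: module_pair.module_hom_add module_pair.module_hom_scale)
qed

lemma deform_map_module_hom:
  assumes "module_hom s1 s2 f" "module_hom s1 s2 \<theta>"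
  shows "module_hom (ext_scale s1) (ext_scale s2) (deform_map s2 f \<theta>)"
proof -
  have "module_pair (ext_scale s1) (ext_scale s2)"
    using assms(1) by (simp add: module_pair_def module_hom_iff ext_scale_module)
  with assms[THEN ext_lin_module_hom] show ?thesis
    unfolding deform_map_def
    by (auto intro!: module_pair.module_hom_add module_pair.module_hom_scale)
qed

lemma ext_scale_zero_right: "module s \<Longrightarrow> ext_scale s c 0 = 0"
  using module.scale_zero_right[OF ext_scale_module] .

lemma ext_zero: "ext_bilin (\<lambda>a b. 0) x y = 0" "ext_lin (\<lambda>a. 0) z = 0"
  by (simp_all add: ext_bilin_def ext_lin_def fps_eq_iff)

lemma deform_mult_zero: "module s \<Longrightarrow> deform_mult s m (\<lambda>x y. 0) = ext_bilin m"
  by (simp add: fun_eq_iff deform_mult_def ext_zero ext_scale_zero_right)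

lemma deform_map_zero: "module s \<Longrightarrow> deform_map s f (\<lambda>x. 0) = ext_lin f"
  by (simp add: fun_eq_iff deform_map_def ext_zero ext_scale_zero_right)

lemma deform_map_id_nth:
  assumes "module s"
  shows "fps_nth (deform_map s id N x) n =
    fps_nth x n + (if n = 0 then 0 else N (fps_nth x (n - 1)))"
  using assms by (simp add: deform_map_def ext_scale_X_nth ext_lin_def)

text \<open>
  The equation \<open>(Id + t N) x = y\<close> reads \<open>x\<^sub>n = y\<^sub>n - N x\<^sub>n\<^sub>-\<^sub>1\<close>, a recursion that determines the
  coefficients of \<open>x\<close>.
\<close>

lemma deform_map_id_bij:
  assumes "module s"
  shows "bij (deform_map s id N)"
proof (rule bijI)
  show "inj (deform_map s id N)"
  proof (rule injI, rule fps_ext)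
    fix x y n
    assume "deform_map s id N x = deform_map s id N y"
    then have eq: "fps_nth x n + (if n = 0 then 0 else N (fps_nth x (n - 1))) =
        fps_nth y n + (if n = 0 then 0 else N (fps_nth y (n - 1)))" for n
      using deform_map_id_nth[OF assms] by metis
    show "fps_nth x n = fps_nth y n"
    proof (induction n)
      case 0
      then show ?case using eq[of 0] by simp
    next
      case (Suc n)
      then show ?case using eq[of "Suc n"] by simp
    qed
  qed
  show "surj (deform_map s id N)"
  proof (rule surjI)
    fix y
    let ?x = "Abs_fps (rec_nat (fps_nth y 0) (\<lambda>n a. fps_nth y (Suc n) - N a))"
    show "deform_map s id N ?x = y"
    proof (rule fps_ext)
      fix n
      show "fps_nth (deform_map s id N ?x) n = fps_nth y n"
        by (cases n) (simp_all add: deform_map_id_nth[OF assms])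
    qed
  qed
qed

lemma pre_lie_algebra_pullback:
  assumes "pre_lie_algebra s2 m2" "module_hom s1 s2 f" "inj f"
    and "bilinear_map s1 s1 s1 m1"
    and mult: "\<And>x y. f (m1 x y) = m2 (f x) (f y)"
  shows "pre_lie_algebra s1 m1"
proof -
  interpret f: module_hom s1 s2 f by fact
  interpret cod: pre_lie_algebra s2 m2 by fact
  show ?thesis
  proof
    fix x y z
    have "f (m1 (m1 x y) z - m1 x (m1 y z)) = f (m1 (m1 y x) z - m1 y (m1 x z))"
      by (simp add: f.diff mult cod.pre_lie)
    then show "m1 (m1 x y) z - m1 x (m1 y z) = m1 (m1 y x) z - m1 y (m1 x z)"
      using \<open>inj f\<close> by (simp add: inj_eq)
  qed fact
qed


section \<open>The deformation generated by a Nijenhuis operator\<close>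

lemma nijenhuis_bracket_bilinear:
  assumes "bilinear_map s s s m" "module_hom s s N"
  shows "bilinear_map s s s (\<lambda>x y. m x (N y) + m (N x) y - N (m x y))"
  using assms by (auto simp: bilinear_map_def module_hom_iff module.scale_right_distrib
      module.scale_right_diff_distrib)

text \<open>
  The Nijenhuis identity and the formula for \<open>\<omega>\<close> pass to the extensions of \<open>m\<close>, \<open>\<omega>\<close>
  and \<open>N\<close>, so powers of \<open>t\<close> can be compared for arbitrary series \<open>x\<close>, \<open>y\<close> and not just for
  constant ones.
\<close>

lemma nijenhuis_deform_mult:
  assumes "pre_lie_algebra s m" "nijenhuis_operator s m N"
    and \<omega>: "\<omega> = (\<lambda>x y. m x (N y) + m (N x) y - N (m x y))"
  shows "deform_map s id N (deform_mult s m \<omega> x y) =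
    ext_bilin m (deform_map s id N x) (deform_map s id N y)"
proof -
  interpret pre_lie_algebra s m by fact
  have hom: "module_hom s s N" and nij: "m (N a) (N b) = N (\<omega> a b)" for a b
    using assms(2) by (auto simp: nijenhuis_operator_def linear_iff_module_hom \<omega> add.commute)
  define M where "M = ext_bilin m"
  define W where "W = ext_bilin \<omega>"
  define L where "L = ext_lin N"
  define T where "T = ext_scale s fps_X"
  interpret L: module_hom "ext_scale s" "ext_scale s" L
    unfolding L_def by (rule ext_lin_module_hom[OF hom])
  have T_add: "T (a + b) = T a + T b" for a b
    by (simp add: T_def L.m1.scale_right_distrib)
  have LT: "L (T a) = T (L a)" for a
    by (simp add: T_def L.scale)
  have M_bilin: "bilinear_map (ext_scale s) (ext_scale s) (ext_scale s) M"
    unfolding M_def by (rule ext_bilin_bilinear[OF bilinear])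
  have M_add: "M (a + b) c = M a c + M b c" "M a (b + c) = M a b + M a c"
    and MT: "M (T a) c = T (M a c)" "M a (T c) = T (M a c)" for a b c
    using M_bilin by (simp_all add: bilinear_map_def module_hom_iff T_def)
  \<comment> \<open>The two nontrivial degrees in \<open>t\<close>: the formula for \<open>\<omega>\<close>, and the Nijenhuis identity.\<close>
  have W: "W a b = M a (L b) + M (L a) b - L (M a b)" for a b
    unfolding W_def M_def L_def \<omega> ext_bilin_add_diff
    by (simp add: ext_bilin_ext_lin ext_lin_ext_bilin module_hom_additive[OF hom])
  have LW: "M (L a) (L b) = L (W a b)" for a b
    unfolding W_def M_def L_def
    by (simp add: ext_bilin_ext_lin ext_lin_ext_bilin module_hom_additive[OF hom] nij)
  have E: "deform_map s id N a = a + T (L a)" for a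
    by (rule fps_ext) (simp add: deform_map_def T_def L_def ext_lin_def)
  have "deform_map s id N (deform_mult s m \<omega> x y) =
      M x y + T (W x y + L (M x y)) + T (T (L (W x y)))"
    unfolding E by (simp add: deform_mult_def L.add LT T_add add.assoc
        flip: M_def W_def T_def)
  also have "W x y + L (M x y) = M x (L y) + M (L x) y"
    by (simp add: W)
  also have "L (W x y) = M (L x) (L y)"
    by (simp add: LW)
  finally show ?thesis
    unfolding E M_def[symmetric] by (simp add: M_add MT T_add ac_simps)
qed

lemma nijenhuis_deform_iso:
  assumes "pre_lie_algebra s m" "nijenhuis_operator s m N"
    and \<omega>: "\<omega> = (\<lambda>x y. m x (N y) + m (N x) y - N (m x y))"
  shows "bilinear_map s s s \<omega>"
    and "pre_lie_iso (ext_scale s) (deform_mult s m \<omega>) (ext_scale s) (ext_bilin m)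
      (deform_map s id N)"
proof -
  interpret pre_lie_algebra s m by fact
  have hom: "module_hom s s N"
    using assms(2) by (simp add: nijenhuis_operator_def linear_iff_module_hom)
  show bil: "bilinear_map s s s \<omega>"
    unfolding \<omega> by (rule nijenhuis_bracket_bilinear[OF bilinear hom])
  have E: "module_hom (ext_scale s) (ext_scale s) (deform_map s id N)"
    by (rule deform_map_module_hom[OF module_hom_id hom])
  note bij = deform_map_id_bij[OF module_axioms, of N]
  note mult = nijenhuis_deform_mult[OF assms]
  have "pre_lie_algebra (ext_scale s) (deform_mult s m \<omega>)"
    by (rule pre_lie_algebra_pullback[OF ext_bilin_pre_lie[OF assms(1)] E bij_is_inj[OF bij]
          deform_mult_bilinear[OF bilinear bil]])
      (rule mult)
  then show "pre_lie_iso (ext_scale s) (deform_mult s m \<omega>) (ext_scale s) (ext_bilin m)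
      (deform_map s id N)"
    using ext_bilin_pre_lie[OF assms(1)] E bij mult
    by (simp add: pre_lie_iso_def pre_lie_iso_axioms_def pre_lie_hom_def pre_lie_hom_axioms_def)
qed


section \<open>The deformation generated by a Nijenhuis pair\<close>

lemma nijenhuis_pair_intertwines:
  assumes "module_hom sg sh \<phi>" "module_hom sh sh S"
    and comp: "S \<circ> \<phi> \<circ> N = S \<circ> S \<circ> \<phi>"
    and \<theta>: "\<theta> = (\<lambda>x. \<phi> (N x) - S (\<phi> x))"
  shows "ext_lin \<phi> (deform_map sg id N x) = deform_map sh id S (deform_map sh \<phi> \<theta> x)"
proof (rule fps_ext)
  fix n
  interpret \<phi>: module_hom sg sh \<phi> by fact
  interpret S: module_hom sh sh S by fact
  have S\<phi>N: "S (\<phi> (N a)) = S (S (\<phi> a))" for a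
    using fun_cong[OF comp, of a] by simp
  have "fps_nth (deform_map sh \<phi> \<theta> x) k =
      \<phi> (fps_nth x k) + (if k = 0 then 0 else \<theta> (fps_nth x (k - 1)))" for k
    by (simp add: deform_map_def ext_scale_X_nth \<phi>.m2.module_axioms ext_lin_def)
  then show "fps_nth (ext_lin \<phi> (deform_map sg id N x)) n =
      fps_nth (deform_map sh id S (deform_map sh \<phi> \<theta> x)) n"
    by (simp add: ext_lin_def deform_map_id_nth \<phi>.m1.module_axioms \<phi>.m2.module_axioms
        \<phi>.add S.add S.diff S\<phi>N \<theta>)
qed

lemma nijenhuis_pair_generates_deformation:
  assumes triple: "pre_lie_morphism_triple sg mg sh mh \<phi>"
    and pair: "nijenhuis_pair sg mg sh mh \<phi> N S"
    and \<omega>: "\<omega> = (\<lambda>x y. mg x (N y) + mg (N x) y - N (mg x y))"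
    and \<pi>: "\<pi> = (\<lambda>u v. mh u (S v) + mh (S u) v - S (mh u v))"
    and \<theta>: "\<theta> = (\<lambda>x. \<phi> (N x) - S (\<phi> x))"
  shows "generates_deformation sg mg sh mh \<phi> \<omega> \<pi> \<theta>"
proof -
  interpret pre_lie_morphism_triple sg mg sh mh \<phi> by fact
  have N: "nijenhuis_operator sg mg N" and S: "nijenhuis_operator sh mh S"
    and comp: "S \<circ> \<phi> \<circ> N = S \<circ> S \<circ> \<phi>"
    using pair by (auto simp: nijenhuis_pair_def)
  have hom_N: "module_hom sg sg N" and hom_S: "module_hom sh sh S"
    using N S by (simp_all add: nijenhuis_operator_def linear_iff_module_hom)
  note iso_g = nijenhuis_deform_iso[OF dom.pre_lie_algebra_axioms N \<omega>]
  note iso_h = nijenhuis_deform_iso[OF cod.pre_lie_algebra_axioms S \<pi>]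
  let ?E = "deform_map sg id N" and ?F = "deform_map sh id S"
  let ?\<phi> = "deform_map sh \<phi> \<theta>"
  interpret E: pre_lie_iso "ext_scale sg" "deform_mult sg mg \<omega>" "ext_scale sg" "ext_bilin mg" ?E
    by (rule iso_g)
  interpret F: pre_lie_iso "ext_scale sh" "deform_mult sh mh \<pi>" "ext_scale sh" "ext_bilin mh" ?F
    by (rule iso_h)
  have hom_\<theta>: "module_hom sg sh \<theta>"
    using module_hom_axioms hom_N hom_S
    by (simp add: \<theta> module_hom_iff module.scale_right_diff_distrib)
  have \<phi>_mult: "ext_lin \<phi> (ext_bilin mg x y) = ext_bilin mh (ext_lin \<phi> x) (ext_lin \<phi> y)" for x y
    by (simp add: ext_lin_ext_bilin ext_bilin_ext_lin hom_mult
        module_hom_additive[OF module_hom_axioms])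
  note inter = nijenhuis_pair_intertwines[OF module_hom_axioms hom_S comp \<theta>]
  \<comment> \<open>Both sides equal \<open>\<phi> (E x) \<cdot> \<phi> (E y)\<close>.\<close>
  have "?F (?\<phi> (deform_mult sg mg \<omega> x y)) = ?F (deform_mult sh mh \<pi> (?\<phi> x) (?\<phi> y))" for x y
    by (simp add: E.hom_mult F.hom_mult \<phi>_mult flip: inter)
  then have "?\<phi> (deform_mult sg mg \<omega> x y) = deform_mult sh mh \<pi> (?\<phi> x) (?\<phi> y)" for x y
    using bij_is_inj[OF F.bij] by (simp add: inj_eq)
  moreover have "Vector_Spaces.linear sg sh \<theta>"
    using hom_\<theta> by (simp add: linear_iff_module_hom)
  ultimately show ?thesis
    unfolding generates_deformation_def
    using iso_g(1) iso_h(1) E.dom.pre_lie_algebra_axioms F.dom.pre_lie_algebra_axioms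
      deform_map_module_hom[OF module_hom_axioms hom_\<theta>] by simp
qed

theorem theorem3p7:
  fixes sg :: "'k::{alg_closed_field,field_char_0} \<Rightarrow> 'g::ab_group_add \<Rightarrow> 'g"
    and sh :: "'k \<Rightarrow> 'h::ab_group_add \<Rightarrow> 'h"
    and mg :: "'g \<Rightarrow> 'g \<Rightarrow> 'g" and mh :: "'h \<Rightarrow> 'h \<Rightarrow> 'h" and \<phi> :: "'g \<Rightarrow> 'h"
    and N :: "'g \<Rightarrow> 'g" and S :: "'h \<Rightarrow> 'h"
    and \<omega> :: "'g \<Rightarrow> 'g \<Rightarrow> 'g" and \<pi> :: "'h \<Rightarrow> 'h \<Rightarrow> 'h" and \<theta> :: "'g \<Rightarrow> 'h"
  assumes "pre_lie_morphism_triple sg mg sh mh \<phi>"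
    and "nijenhuis_pair sg mg sh mh \<phi> N S"
    and "\<And>x y. \<omega> x y = mg x (N y) + mg (N x) y - N (mg x y)"
    and "\<And>u v. \<pi> u v = mh u (S v) + mh (S u) v - S (mh u v)"
    and "\<And>x. \<theta> x = \<phi> (N x) - S (\<phi> x)"
  shows "generates_deformation sg mg sh mh \<phi> \<omega> \<pi> \<theta> \<and>
    trivial_deformation sg mg sh mh \<phi> \<omega> \<pi> \<theta>"
proof -
  interpret pre_lie_morphism_triple sg mg sh mh \<phi> by fact
  have N: "nijenhuis_operator sg mg N" and S: "nijenhuis_operator sh mh S"
    and comp: "S \<circ> \<phi> \<circ> N = S \<circ> S \<circ> \<phi>"
    using assms(2) by (auto simp: nijenhuis_pair_def)
  have lin: "Vector_Spaces.linear sg sg N" "Vector_Spaces.linear sh sh S"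
    using N S by (simp_all add: nijenhuis_operator_def)
  have hom_S: "module_hom sh sh S"
    using lin(2) by (simp add: linear_iff_module_hom)
  have \<omega>: "\<omega> = (\<lambda>x y. mg x (N y) + mg (N x) y - N (mg x y))"
    and \<pi>: "\<pi> = (\<lambda>u v. mh u (S v) + mh (S u) v - S (mh u v))"
    and \<theta>: "\<theta> = (\<lambda>x. \<phi> (N x) - S (\<phi> x))"
    using assms(3-5) by (simp_all add: fun_eq_iff)
  have gen: "generates_deformation sg mg sh mh \<phi> \<omega> \<pi> \<theta>"
    by (rule nijenhuis_pair_generates_deformation[OF assms(1,2) \<omega> \<pi> \<theta>])
  note zero_g = bilinear_map_zero[OF dom.bilinear]
  note zero_h = bilinear_map_zero[OF cod.bilinear]
  \<comment> \<open>The undeformed triple is the deformation given by the Nijenhuis pair \<open>(0, 0)\<close>.\<close>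
  have "nijenhuis_pair sg mg sh mh \<phi> (\<lambda>x. 0) (\<lambda>u. 0)"
    by (auto simp: nijenhuis_pair_def nijenhuis_operator_def linear_iff_module_hom module_hom_iff
        dom.module_axioms cod.module_axioms zero_g zero_h)
  then have gen0: "generates_deformation sg mg sh mh \<phi> (\<lambda>x y. 0) (\<lambda>u v. 0) (\<lambda>x. 0)"
    by (rule nijenhuis_pair_generates_deformation[OF assms(1)]) (simp_all add: zero_g zero_h)
  have "ext_lin \<phi> \<circ> deform_map sg id N = deform_map sh id S \<circ> deform_map sh \<phi> \<theta>"
    using nijenhuis_pair_intertwines[OF module_hom_axioms hom_S comp \<theta>]
    by (simp add: fun_eq_iff)
  then have "trivial_deformation sg mg sh mh \<phi> \<omega> \<pi> \<theta>"
    unfolding trivial_deformation_def equivalent_deformations_def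
      deform_mult_zero[OF dom.module_axioms] deform_mult_zero[OF cod.module_axioms]
      deform_map_zero[OF cod.module_axioms]
    using gen gen0 lin
      nijenhuis_deform_iso(2)[OF dom.pre_lie_algebra_axioms N \<omega>]
      nijenhuis_deform_iso(2)[OF cod.pre_lie_algebra_axioms S \<pi>]
    by blast
  with gen show ?thesis ..
qed

end
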